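(* Let $(X,d)$ be a separable metric space without isolated points and let $M$ be a defining structure of $(X,d)$ in the language $\mathcal{L}$. Let $V_1$ and $V_2$ be two independent dense subsets of $X$. Suppose thickness is definable in $M$ and $G_1=(V_1,E_1)$, $G_2=(V_2,E_2)$ are g.e.c. graphs in $(X,d)$. Then $(G_1)_{\mathrm{ind}}$ and $(G_2)_{\mathrm{ind}}$ are elementarily equivalent in $\mathcal{L}_{\mathrm{ind}}^{E}$ (and hence also in the graph language $\mathcal{L}_G=\{E\}$ and in $\mathcal{L}_{\mathrm{ind}}$). Moreover, both $(V_1)_{\mathrm{ind}}$ and $(G_1)_{\mathrm{ind}}$ have quantifier elimination (in the languages $\mathcal{L}_{\mathrm{ind}}$ and $\mathcal{L}_{\mathrm{ind}}^E$ respectively).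
   Context: Let $(X,d)$ be a separable metric space without isolated points. Defining structure: an $\mathcal{L}$-structure $M$ is a defining structure of $(X,d)$ if $X\subseteq M^n$ is an $\mathcal{L}$-definable set for some $n\in\mathbb{N}$ and the binary relation $d(x,y)<1$ on $X$ is $\mathcal{L}$-definable over $\emptyset$. Elements of $X$ are thus $n$-tuples of $M$; variables "in the sort of $X$" are $n$-tuples of variables ranging over $X$, and $\varphi(X,\bar b)=\{x\in X: M\models\varphi(x,\bar b)\}$. Thick/thin: a definable subset $A\subseteq X$ is thick if it contains a non-empty open ball of $(X,d)$; otherwise it is thin. Thickness is definable in $M$ if for every $\mathcal{L}$-formula $\varphi(x,y)$ without parameters, with $|x|=n$ and $|y|=mn$, there is a formula $\psi(y)$ without parameters such that for every $\bar b\in X^m$: $M\models\psi(\bar b)$ iff $\varphi(X,\bar b)$ is thick. Independent: a subset $Y\subseteq X$ is independent if for every $\mathcal{L}$-formula $\varphi(x,y)$ with $|x|=n$, $|y|=mn$, $m\in\mathbb{N}$, and every $\bar b\in Y^m$, if $\varphi(X,\bar b)$ is thin then $Y\cap\varphi(X,\bar b)\subseteq\bar b$ (the set of entries of $\bar b$). g.e.c.: a (simple, undirected) graph $G$ with vertex set a dense $S\subseteq X$ is geometrically existentially closed if (i) any two adjacent $u,v\in S$ satisfy $d(u,v)<1$; and (ii) for any $s\in S$, any disjoint finite $A,B\subseteq S$ contained in the open unit ball $B_1(s)$, and any $\epsilon>0$, there is $v\in S\setminus(A\cup B)$ with $d(s,v)<\epsilon$ adjacent to every vertex in $A$ and to no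 vertex in $B$. Induced structures: let $\mathcal{L}_{\mathrm{ind}}=\{R_\phi:\phi(x_1,\ldots,x_k)\in\mathcal{L},\ x_i\text{ variables in the sort of }X\}$, with $R_\phi$ a $k$-ary relation symbol, and $\mathcal{L}_{\mathrm{ind}}^E=\mathcal{L}_{\mathrm{ind}}\cup\{E\}$. For a graph $G=(V,E)$ with $V\subseteq X$, $V_{\mathrm{ind}}$ is the $\mathcal{L}_{\mathrm{ind}}$-structure and $G_{\mathrm{ind}}$ the $\mathcal{L}_{\mathrm{ind}}^E$-structure with universe $V$, where $R_\phi$ is interpreted as $\{(a_1,\ldots,a_k)\in V^k: M\models\phi(a_1,\ldots,a_k)\}$ and $E$ is the edge relation. A structure has quantifier elimination if its complete theory does. *)

theory Defs
  imports "HOL-Analysis.Analysis"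
begin

section \<open>First-order logic\<close>

text \<open>Only the symbols in \<open>fun_syms\<close> and \<open>rel_syms\<close> belong to the language (so it may have no
  function symbols at all); constants are function symbols of arity \<open>0\<close>.\<close>

record ('f, 'r) language =
  fun_syms :: "'f set"
  fun_arity :: "'f \<Rightarrow> nat"
  rel_syms :: "'r set"
  rel_arity :: "'r \<Rightarrow> nat"

datatype 'f tm = Var nat | Fn 'f "'f tm list"

datatype ('f, 'r) fm =
    Falsum
  | Eq "'f tm" "'f tm"
  | Rel 'r "'f tm list"
  | Imp "('f, 'r) fm" "('f, 'r) fm"
  | Forall nat "('f, 'r) fm"

abbreviation Neg :: "('f, 'r) fm \<Rightarrow> ('f, 'r) fm" where
  "Neg \<phi> \<equiv> Imp \<phi> Falsum"

abbreviation Conj :: "('f, 'r) fm \<Rightarrow> ('f, 'r) fm \<Rightarrow> ('f, 'r) fm" where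
  "Conj \<phi> \<psi> \<equiv> Neg (Imp \<phi> (Neg \<psi>))"

abbreviation Iff :: "('f, 'r) fm \<Rightarrow> ('f, 'r) fm \<Rightarrow> ('f, 'r) fm" where
  "Iff \<phi> \<psi> \<equiv> Conj (Imp \<phi> \<psi>) (Imp \<psi> \<phi>)"

fun wf_tm :: "('f, 'r) language \<Rightarrow> 'f tm \<Rightarrow> bool" where
  "wf_tm L (Var i) \<longleftrightarrow> True"
| "wf_tm L (Fn f ts) \<longleftrightarrow>
     f \<in> fun_syms L \<and> length ts = fun_arity L f \<and> (\<forall>t\<in>set ts. wf_tm L t)"

fun wf_fm :: "('f, 'r) language \<Rightarrow> ('f, 'r) fm \<Rightarrow> bool" where
  "wf_fm L Falsum \<longleftrightarrow> True"
| "wf_fm L (Eq s t) \<longleftrightarrow> wf_tm L s \<and> wf_tm L t"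
| "wf_fm L (Rel r ts) \<longleftrightarrow>
     r \<in> rel_syms L \<and> length ts = rel_arity L r \<and> (\<forall>t\<in>set ts. wf_tm L t)"
| "wf_fm L (Imp \<phi> \<psi>) \<longleftrightarrow> wf_fm L \<phi> \<and> wf_fm L \<psi>"
| "wf_fm L (Forall i \<phi>) \<longleftrightarrow> wf_fm L \<phi>"

fun fv_tm :: "'f tm \<Rightarrow> nat set" where
  "fv_tm (Var i) = {i}"
| "fv_tm (Fn f ts) = (\<Union>t\<in>set ts. fv_tm t)"

fun fv :: "('f, 'r) fm \<Rightarrow> nat set" where
  "fv Falsum = {}"
| "fv (Eq s t) = fv_tm s \<union> fv_tm t"
| "fv (Rel r ts) = (\<Union>t\<in>set ts. fv_tm t)"
| "fv (Imp \<phi> \<psi>) = fv \<phi> \<union> fv \<psi>"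
| "fv (Forall i \<phi>) = fv \<phi> - {i}"

fun quantifier_free :: "('f, 'r) fm \<Rightarrow> bool" where
  "quantifier_free (Imp \<phi> \<psi>) \<longleftrightarrow> quantifier_free \<phi> \<and> quantifier_free \<psi>"
| "quantifier_free (Forall i \<phi>) \<longleftrightarrow> False"
| "quantifier_free _ \<longleftrightarrow> True"

text \<open>Tuples are lists: \<open>tuples A k\<close> is $A^k$.\<close>

definition tuples :: "'a set \<Rightarrow> nat \<Rightarrow> 'a list set" where
  "tuples A k = {xs. length xs = k \<and> set xs \<subseteq> A}"

record ('f, 'r, 'a) struct =
  univ :: "'a set"
  fun_int :: "'f \<Rightarrow> 'a list \<Rightarrow> 'a"
  rel_int :: "'r \<Rightarrow> 'a list set"

text \<open>Relation symbols may be interpreted by lists outside the universe or of the wrong length;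
  these are never consulted by well-formed formulas.\<close>

definition is_structure :: "('f, 'r) language \<Rightarrow> ('f, 'r, 'a) struct \<Rightarrow> bool" where
  "is_structure L M \<longleftrightarrow> univ M \<noteq> {} \<and>
     (\<forall>f\<in>fun_syms L. \<forall>xs\<in>tuples (univ M) (fun_arity L f). fun_int M f xs \<in> univ M)"

fun tm_val :: "('f, 'r, 'a) struct \<Rightarrow> (nat \<Rightarrow> 'a) \<Rightarrow> 'f tm \<Rightarrow> 'a" where
  "tm_val M e (Var i) = e i"
| "tm_val M e (Fn f ts) = fun_int M f (map (tm_val M e) ts)"

fun sat :: "('f, 'r, 'a) struct \<Rightarrow> (nat \<Rightarrow> 'a) \<Rightarrow> ('f, 'r) fm \<Rightarrow> bool" where
  "sat M e Falsum \<longleftrightarrow> False"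
| "sat M e (Eq s t) \<longleftrightarrow> tm_val M e s = tm_val M e t"
| "sat M e (Rel r ts) \<longleftrightarrow> map (tm_val M e) ts \<in> rel_int M r"
| "sat M e (Imp \<phi> \<psi>) \<longleftrightarrow> (sat M e \<phi> \<longrightarrow> sat M e \<psi>)"
| "sat M e (Forall i \<phi>) \<longleftrightarrow> (\<forall>a\<in>univ M. sat M (e(i := a)) \<phi>)"

text \<open>\<open>formula_in L k \<phi>\<close>: \<open>\<phi>\<close> is a parameter-free formula $\varphi(v_0,\dots,v_{k-1})$;
  \<open>holds M \<phi> xs\<close>: $M \models \varphi(\bar x)$, where $v_i$ is evaluated as the $i$-th entry.\<close>

definition formula_in :: "('f, 'r) language \<Rightarrow> nat \<Rightarrow> ('f, 'r) fm \<Rightarrow> bool" where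
  "formula_in L k \<phi> \<longleftrightarrow> wf_fm L \<phi> \<and> fv \<phi> \<subseteq> {..<k}"

definition holds :: "('f, 'r, 'a) struct \<Rightarrow> ('f, 'r) fm \<Rightarrow> 'a list \<Rightarrow> bool" where
  "holds M \<phi> xs \<longleftrightarrow> sat M (\<lambda>i. xs ! i) \<phi>"

definition sentence :: "('f, 'r) language \<Rightarrow> ('f, 'r) fm \<Rightarrow> bool" where
  "sentence L \<sigma> \<longleftrightarrow> wf_fm L \<sigma> \<and> fv \<sigma> = {}"

text \<open>Used for sentences only, whose truth does not depend on the assignment (\<open>sat_cong\<close>).\<close>

definition models :: "('f, 'r, 'a) struct \<Rightarrow> ('f, 'r) fm \<Rightarrow> bool" where
  "models M \<sigma> \<longleftrightarrow> (\<forall>e. sat M e \<sigma>)"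

definition complete_theory ::
    "('f, 'r) language \<Rightarrow> ('f, 'r, 'a) struct \<Rightarrow> ('f, 'r) fm set" where
  "complete_theory L M = {\<sigma>. sentence L \<sigma> \<and> models M \<sigma>}"

text \<open>The two structures may interpret more symbols than \<open>L\<close> has, so this also expresses
  elementary equivalence of reducts.\<close>

definition elementarily_equivalent ::
    "('f, 'r) language \<Rightarrow> ('f, 'r, 'a) struct \<Rightarrow> ('f, 'r, 'b) struct \<Rightarrow> bool" where
  "elementarily_equivalent L M N \<longleftrightarrow> complete_theory L M = complete_theory L N"

definition univ_closure :: "('f, 'r) fm \<Rightarrow> ('f, 'r) fm" where
  "univ_closure \<phi> = foldr Forall (sorted_list_of_set (fv \<phi>)) \<phi>"

text \<open>For deductively closed \<open>T\<close>, in particular a complete theory, following from \<open>T\<close> is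
  membership in \<open>T\<close>. The formula \<open>\<psi>\<close> may use only the free variables of \<open>\<phi>\<close>; this makes sense
  also for sentences \<open>\<phi>\<close>, because \<open>Falsum\<close> is an atomic formula.\<close>

definition theory_has_qe :: "('f, 'r) language \<Rightarrow> ('f, 'r) fm set \<Rightarrow> bool" where
  "theory_has_qe L T \<longleftrightarrow>
     (\<forall>\<phi>. wf_fm L \<phi> \<longrightarrow>
       (\<exists>\<psi>. wf_fm L \<psi> \<and> quantifier_free \<psi> \<and> fv \<psi> \<subseteq> fv \<phi> \<and> univ_closure (Iff \<phi> \<psi>) \<in> T))"

definition has_quantifier_elimination ::
    "('f, 'r) language \<Rightarrow> ('f, 'r, 'a) struct \<Rightarrow> bool" where
  "has_quantifier_elimination L M \<longleftrightarrow> theory_has_qe L (complete_theory L M)"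

lemma tm_val_cong:
  "(\<And>i. i \<in> fv_tm t \<Longrightarrow> e i = e' i) \<Longrightarrow> tm_val M e t = tm_val M e' t"
proof (induction t)
  case (Fn f ts)
  then have "map (tm_val M e) ts = map (tm_val M e') ts" by auto
  then show ?case by (simp del: map_eq_conv)
qed simp

lemma sat_cong:
  "(\<And>i. i \<in> fv \<phi> \<Longrightarrow> e i = e' i) \<Longrightarrow> sat M e \<phi> \<longleftrightarrow> sat M e' \<phi>"
proof (induction \<phi> arbitrary: e e')
  case (Eq s t)
  then show ?case by (metis UnCI fv.simps(2) sat.simps(2) tm_val_cong)
next
  case (Rel r ts)
  have "map (tm_val M e) ts = map (tm_val M e') ts"
    by (rule map_cong[OF refl], rule tm_val_cong) (use Rel in auto)
  then show ?case by (simp del: map_eq_conv)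
next
  case (Imp \<phi> \<psi>)
  then show ?case by (metis UnCI fv.simps(4) sat.simps(4))
next
  case (Forall i \<phi>)
  have "sat M (e(i := a)) \<phi> \<longleftrightarrow> sat M (e'(i := a)) \<phi>" for a
    by (rule Forall.IH) (use Forall.prems in auto)
  then show ?case by simp
qed simp

lemma finite_fv_tm: "finite (fv_tm t)"
  by (induction t) auto

lemma finite_fv: "finite (fv \<phi>)"
  by (induction \<phi>) (auto simp: finite_fv_tm)

lemma sat_foldr_Forall:
  "sat M e (foldr Forall is \<phi>) \<longleftrightarrow>
     (\<forall>e'. (\<forall>i. i \<notin> set is \<longrightarrow> e' i = e i) \<and> e' ` set is \<subseteq> univ M \<longrightarrow> sat M e' \<phi>)"
proof (induction "is" arbitrary: e)
  case Nil
  have "e' = e" if "\<forall>i. e' i = e i" for e' using that by auto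
  then show ?case by auto
next
  case (Cons j js)
  have step: "sat M e (foldr Forall (j # js) \<phi>) \<longleftrightarrow>
    (\<forall>a\<in>univ M. \<forall>e'. (\<forall>i. i \<notin> set js \<longrightarrow> e' i = (e(j := a)) i) \<and> e' ` set js \<subseteq> univ M
        \<longrightarrow> sat M e' \<phi>)"
    by (simp add: Cons.IH)
  show ?case
  proof
    assume l: "sat M e (foldr Forall (j # js) \<phi>)"
    show "\<forall>e'. (\<forall>i. i \<notin> set (j # js) \<longrightarrow> e' i = e i) \<and> e' ` set (j # js) \<subseteq> univ M \<longrightarrow> sat M e' \<phi>"
    proof (intro allI impI)
      fix e' assume e': "(\<forall>i. i \<notin> set (j # js) \<longrightarrow> e' i = e i) \<and> e' ` set (j # js) \<subseteq> univ M"
      then have "e' j \<in> univ M" by simp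
      moreover have "\<forall>i. i \<notin> set js \<longrightarrow> e' i = (e(j := e' j)) i" using e' by simp
      moreover have "e' ` set js \<subseteq> univ M" using e' by simp
      ultimately show "sat M e' \<phi>" using l[unfolded step] by blast
    qed
  next
    assume r: "\<forall>e'. (\<forall>i. i \<notin> set (j # js) \<longrightarrow> e' i = e i) \<and> e' ` set (j # js) \<subseteq> univ M
      \<longrightarrow> sat M e' \<phi>"
    show "sat M e (foldr Forall (j # js) \<phi>)"
      unfolding step
    proof (intro ballI allI impI)
      fix a e' assume a: "a \<in> univ M"
        and e': "(\<forall>i. i \<notin> set js \<longrightarrow> e' i = (e(j := a)) i) \<and> e' ` set js \<subseteq> univ M"
      have "e' j \<in> univ M" using a e' by (cases "j \<in> set js") auto
      then have "e' ` set (j # js) \<subseteq> univ M" using e' by simp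
      moreover have "\<forall>i. i \<notin> set (j # js) \<longrightarrow> e' i = e i" using e' by simp
      ultimately show "sat M e' \<phi>" using r by blast
    qed
  qed
qed

lemma models_univ_closure:
  "models M (univ_closure \<phi>) \<longleftrightarrow> (\<forall>e. e ` fv \<phi> \<subseteq> univ M \<longrightarrow> sat M e \<phi>)"
  unfolding models_def univ_closure_def sat_foldr_Forall by (auto simp: finite_fv)

lemma sentence_univ_closure:
  assumes "wf_fm L \<phi>" shows "sentence L (univ_closure \<phi>)"
proof -
  have "wf_fm L (foldr Forall is \<phi>)" "fv (foldr Forall is \<phi>) = fv \<phi> - set is" for "is"
    using assms by (induction "is") auto
  then show ?thesis by (simp add: sentence_def univ_closure_def finite_fv)
qed


section \<open>Definable sets and defining structures of metric spaces\<close>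

text \<open>\<open>definable L M C k A\<close>: $A \subseteq M^k$ is definable with parameters from \<open>C\<close>.\<close>

definition definable ::
    "('f, 'r) language \<Rightarrow> ('f, 'r, 'm) struct \<Rightarrow> 'm set \<Rightarrow> nat \<Rightarrow> 'm list set \<Rightarrow> bool" where
  "definable L M C k A \<longleftrightarrow>
     (\<exists>l \<phi>. \<exists>cs\<in>tuples C l. formula_in L (k + l) \<phi> \<and>
        A = {xs \<in> tuples (univ M) k. holds M \<phi> (xs @ cs)})"

text \<open>A pair of $n$-tuples is identified with the $2n$-tuple obtained by concatenation.\<close>

definition defining_structure ::
    "('f, 'r) language \<Rightarrow> ('f, 'r, 'm) struct \<Rightarrow> nat \<Rightarrow> 'm list set \<Rightarrow>
      ('m list \<Rightarrow> 'm list \<Rightarrow> real) \<Rightarrow> bool" where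
  "defining_structure L M n X d \<longleftrightarrow>
     is_structure L M \<and>
     X \<subseteq> tuples (univ M) n \<and> definable L M (univ M) n X \<and>
     definable L M {} (2 * n) {x @ y | x y. x \<in> X \<and> y \<in> X \<and> d x y < 1}"

text \<open>The set $\varphi(X,\bar b)$ for $\varphi(x,y)$ and $\bar b \in X^m$: the variables
  $v_0,\dots,v_{n-1}$ form $x$, and $v_{n+jn},\dots,v_{n+jn+n-1}$ stand for the $j$-th entry of
  $\bar b$.\<close>

definition solution_set ::
    "('f, 'r, 'm) struct \<Rightarrow> 'm list set \<Rightarrow> ('f, 'r) fm \<Rightarrow> 'm list list \<Rightarrow> 'm list set" where
  "solution_set M X \<phi> bs = {x \<in> X. holds M \<phi> (x @ concat bs)}"

definition thick :: "'a set \<Rightarrow> ('a \<Rightarrow> 'a \<Rightarrow> real) \<Rightarrow> 'a set \<Rightarrow> bool" where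
  "thick X d A \<longleftrightarrow>
     (\<exists>x r. Metric_space.mball X d x r \<noteq> {} \<and> Metric_space.mball X d x r \<subseteq> A)"

abbreviation thin :: "'a set \<Rightarrow> ('a \<Rightarrow> 'a \<Rightarrow> real) \<Rightarrow> 'a set \<Rightarrow> bool" where
  "thin X d A \<equiv> \<not> thick X d A"

definition thickness_definable ::
    "('f, 'r) language \<Rightarrow> ('f, 'r, 'm) struct \<Rightarrow> nat \<Rightarrow> 'm list set \<Rightarrow>
      ('m list \<Rightarrow> 'm list \<Rightarrow> real) \<Rightarrow> bool" where
  "thickness_definable L M n X d \<longleftrightarrow>
     (\<forall>m \<phi>. formula_in L (n + m * n) \<phi> \<longrightarrow>
       (\<exists>\<psi>. formula_in L (m * n) \<psi> \<and>
         (\<forall>bs\<in>tuples X m. holds M \<psi> (concat bs) \<longleftrightarrow> thick X d (solution_set M X \<phi> bs))))"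

definition independent_set ::
    "('f, 'r) language \<Rightarrow> ('f, 'r, 'm) struct \<Rightarrow> nat \<Rightarrow> 'm list set \<Rightarrow>
      ('m list \<Rightarrow> 'm list \<Rightarrow> real) \<Rightarrow> 'm list set \<Rightarrow> bool" where
  "independent_set L M n X d Y \<longleftrightarrow>
     Y \<subseteq> X \<and>
     (\<forall>m \<phi>. formula_in L (n + m * n) \<phi> \<longrightarrow>
       (\<forall>bs\<in>tuples Y m. thin X d (solution_set M X \<phi> bs) \<longrightarrow>
          Y \<inter> solution_set M X \<phi> bs \<subseteq> set bs))"


section \<open>Geometrically existentially closed graphs\<close>

definition dense_subset :: "'a set \<Rightarrow> ('a \<Rightarrow> 'a \<Rightarrow> real) \<Rightarrow> 'a set \<Rightarrow> bool" where
  "dense_subset X d S \<longleftrightarrow> S \<subseteq> X \<and> Metric_space.mtopology X d closure_of S = X"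

definition without_isolated_points :: "'a set \<Rightarrow> ('a \<Rightarrow> 'a \<Rightarrow> real) \<Rightarrow> bool" where
  "without_isolated_points X d \<longleftrightarrow> (\<forall>x\<in>X. \<not> openin (Metric_space.mtopology X d) {x})"

definition simple_graph :: "'a set \<Rightarrow> ('a \<times> 'a) set \<Rightarrow> bool" where
  "simple_graph V E \<longleftrightarrow> E \<subseteq> V \<times> V \<and> sym E \<and> irrefl E"

definition gec_graph ::
    "'a set \<Rightarrow> ('a \<Rightarrow> 'a \<Rightarrow> real) \<Rightarrow> 'a set \<Rightarrow> ('a \<times> 'a) set \<Rightarrow> bool" where
  "gec_graph X d S E \<longleftrightarrow>
     simple_graph S E \<and> dense_subset X d S \<and>
     (\<forall>u\<in>S. \<forall>v\<in>S. (u, v) \<in> E \<longrightarrow> d u v < 1) \<and>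
     (\<forall>s\<in>S. \<forall>A B \<epsilon>.
        finite A \<and> finite B \<and> A \<subseteq> S \<and> B \<subseteq> S \<and> A \<inter> B = {} \<and>
        A \<subseteq> Metric_space.mball X d s 1 \<and> B \<subseteq> Metric_space.mball X d s 1 \<and> \<epsilon> > 0 \<longrightarrow>
        (\<exists>v \<in> S - (A \<union> B). d s v < \<epsilon> \<and> (\<forall>a\<in>A. (v, a) \<in> E) \<and> (\<forall>b\<in>B. (v, b) \<notin> E)))"


section \<open>Induced structures\<close>

text \<open>\<open>R \<phi> k\<close> is the $k$-ary symbol $R_\varphi$ for $\varphi(x_1,\dots,x_k)$, where each $x_i$ is
  an $n$-tuple of variables. All three languages below share this type of symbols, so that
  reducts need no translation. They have no function symbols.\<close>

datatype ('f, 'r) ind_sym = R "('f, 'r) fm" nat | Edge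

fun ind_arity :: "('f, 'r) ind_sym \<Rightarrow> nat" where
  "ind_arity (R \<phi> k) = k"
| "ind_arity Edge = 2"

definition relational_lang ::
    "('f, 'r) ind_sym set \<Rightarrow> (unit, ('f, 'r) ind_sym) language" where
  "relational_lang S =
     \<lparr>fun_syms = {}, fun_arity = (\<lambda>_. 0), rel_syms = S, rel_arity = ind_arity\<rparr>"

definition L_ind ::
    "('f, 'r) language \<Rightarrow> nat \<Rightarrow> (unit, ('f, 'r) ind_sym) language" where
  "L_ind L n = relational_lang {R \<phi> k | \<phi> k. formula_in L (k * n) \<phi>}"

definition L_ind_E ::
    "('f, 'r) language \<Rightarrow> nat \<Rightarrow> (unit, ('f, 'r) ind_sym) language" where
  "L_ind_E L n = relational_lang (insert Edge {R \<phi> k | \<phi> k. formula_in L (k * n) \<phi>})"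

definition L_graph :: "(unit, ('f, 'r) ind_sym) language" where
  "L_graph = relational_lang {Edge}"

fun ind_rel ::
    "('f, 'r, 'm) struct \<Rightarrow> 'm list set \<Rightarrow> ('m list \<times> 'm list) set \<Rightarrow>
      ('f, 'r) ind_sym \<Rightarrow> 'm list list set" where
  "ind_rel M V E (R \<phi> k) = {as \<in> tuples V k. holds M \<phi> (concat as)}"
| "ind_rel M V E Edge = {[u, v] | u v. (u, v) \<in> E}"

definition G_ind ::
    "('f, 'r, 'm) struct \<Rightarrow> 'm list set \<Rightarrow> ('m list \<times> 'm list) set \<Rightarrow>
      (unit, ('f, 'r) ind_sym, 'm list) struct" where
  "G_ind M V E = \<lparr>univ = V, fun_int = (\<lambda>_ _. undefined), rel_int = ind_rel M V E\<rparr>"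

text \<open>\<open>V_ind M V\<close> is only considered in the language \<open>L_ind L n\<close>, where the edge symbol does not
  occur, so the empty edge relation is a dummy.\<close>

definition V_ind ::
    "('f, 'r, 'm) struct \<Rightarrow> 'm list set \<Rightarrow> (unit, ('f, 'r) ind_sym, 'm list) struct" where
  "V_ind M V = G_ind M V {}"

end

theory Submission
  imports Defs
begin

text \<open>Let \<open>\<theta>(x, a)\<close> be quantifier-free, written with a tuple \<open>a\<close> of parameters from \<open>V\<close>, and fix the
  equalities and edges within \<open>a\<close> and the set \<open>S\<close> of indices of the neighbours of \<open>x\<close> in \<open>a\<close>. For
  \<open>x\<close> outside \<open>a\<close>, the conjunction of \<open>\<theta>\<close> and \<open>d x a\<^sub>i < 1\<close> for all \<open>i \<in> S\<close> is then a condition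
  definable in \<open>M\<close>; let \<open>D\<close> be its solution set. If some such \<open>x \<in> V\<close> exists, \<open>D\<close> is thick by
  independence of \<open>V\<close>. If \<open>D\<close> is thick, it contains a small ball on which each condition
  \<open>d x a\<^sub>j < 1\<close> has constant truth value, and geometric existential closedness provides \<open>x\<close> in that
  ball. So the existence of \<open>x\<close> is equivalent to thickness of \<open>D\<close>, which is an atomic condition
  on \<open>a\<close> because thickness is definable. The resulting quantifier-free formula does not depend on
  \<open>(V, E)\<close>, and a quantifier-free sentence mentions only sentences of \<open>L\<close>, evaluated in \<open>M\<close>; hence
  elementary equivalence.\<close>

section \<open>Renaming variables\<close>

primrec rename_tm :: "(nat \<Rightarrow> nat) \<Rightarrow> 'f tm \<Rightarrow> 'f tm" where
  "rename_tm \<rho> (Var i) = Var (\<rho> i)"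
| "rename_tm \<rho> (Fn f ts) = Fn f (map (rename_tm \<rho>) ts)"

lemma wf_rename_tm [simp]: "wf_tm L (rename_tm \<rho> t) \<longleftrightarrow> wf_tm L t"
  by (induction t) auto

lemma fv_rename_tm [simp]: "fv_tm (rename_tm \<rho> t) = \<rho> ` fv_tm t"
  by (induction t) (auto simp: image_UN)

lemma tm_val_rename_tm [simp]: "tm_val M e (rename_tm \<rho> t) = tm_val M (\<lambda>i. e (\<rho> i)) t"
proof (induction t)
  case (Fn f ts)
  then have "map (tm_val M e \<circ> rename_tm \<rho>) ts = map (tm_val M (\<lambda>i. e (\<rho> i))) ts" by auto
  then show ?case by (simp del: map_eq_conv)
qed simp

text \<open>The map \<open>\<rho>\<close> need not be injective, so capture is avoided by giving
  each bound variable a new name outside the image of the free variables. For this the induction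
  must range over all \<open>\<rho>\<close>: below a quantifier, \<open>\<rho>\<close> is changed at
  the bound variable.\<close>

lemma ex_renamed_formula:
  assumes "wf_fm L \<phi>"
  shows "\<exists>\<xi>. wf_fm L \<xi> \<and> fv \<xi> \<subseteq> \<rho> ` fv \<phi> \<and> (\<forall>e. sat M e \<xi> \<longleftrightarrow> sat M (\<lambda>i. e (\<rho> i)) \<phi>)"
  using assms
proof (induction \<phi> arbitrary: \<rho>)
  case Falsum
  show ?case by (intro exI[of _ Falsum]) simp
next
  case (Eq s t)
  then show ?case by (intro exI[of _ "Eq (rename_tm \<rho> s) (rename_tm \<rho> t)"]) auto
next
  case (Rel r ts)
  have "map (tm_val M e \<circ> rename_tm \<rho>) ts = map (tm_val M (\<lambda>i. e (\<rho> i))) ts" for e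
    by simp
  with Rel show ?case
    by (intro exI[of _ "Rel r (map (rename_tm \<rho>) ts)"]) (auto simp del: map_eq_conv)
next
  case (Imp \<phi> \<psi>)
  then obtain \<phi>' \<psi>' where
    "wf_fm L \<phi>' \<and> fv \<phi>' \<subseteq> \<rho> ` fv \<phi> \<and> (\<forall>e. sat M e \<phi>' \<longleftrightarrow> sat M (\<lambda>i. e (\<rho> i)) \<phi>)"
    "wf_fm L \<psi>' \<and> fv \<psi>' \<subseteq> \<rho> ` fv \<psi> \<and> (\<forall>e. sat M e \<psi>' \<longleftrightarrow> sat M (\<lambda>i. e (\<rho> i)) \<psi>)"
    by (metis wf_fm.simps(4))
  then show ?case by (intro exI[of _ "Imp \<phi>' \<psi>'"]) auto
next
  case (Forall i \<phi>)
  obtain j where j: "j \<notin> \<rho> ` fv \<phi>"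
    using ex_new_if_finite[OF infinite_UNIV_nat] finite_fv by blast
  obtain \<xi> where \<xi>: "wf_fm L \<xi>" "fv \<xi> \<subseteq> (\<rho>(i := j)) ` fv \<phi>"
    "\<And>e. sat M e \<xi> \<longleftrightarrow> sat M (\<lambda>k. e ((\<rho>(i := j)) k)) \<phi>"
    using Forall.IH[of "\<rho>(i := j)"] Forall.prems by auto
  have "sat M (e(j := a)) \<xi> \<longleftrightarrow> sat M ((\<lambda>k. e (\<rho> k))(i := a)) \<phi>" for e a
    unfolding \<xi>(3) by (rule sat_cong) (use j in auto)
  with \<xi> show ?case by (intro exI[of _ "Forall j \<xi>"]) (auto split: if_splits)
qed

lemma nth_concat_uniform:
  assumes "\<forall>x\<in>set xs. length x = n" "q < length xs" "r < n"
  shows "concat xs ! (q * n + r) = xs ! q ! r"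
  using assms
proof (induction xs arbitrary: q)
  case (Cons x xs)
  then show ?case by (cases q) (auto simp: nth_append algebra_simps)
qed simp

section \<open>Metric spaces without isolated points\<close>

context Metric_space
begin

text \<open>Every point of an open set is the centre of a ball inside it. Open sets are more
  convenient than balls here: they survive intersection with balls and removal of finite
  sets.\<close>

lemma thick_iff:
  "thick M d A \<longleftrightarrow> (\<exists>U. openin mtopology U \<and> U \<noteq> {} \<and> U \<subseteq> A)"
proof
  assume "thick M d A"
  then show "\<exists>U. openin mtopology U \<and> U \<noteq> {} \<and> U \<subseteq> A"
    unfolding thick_def using openin_mball by blast
next
  assume "\<exists>U. openin mtopology U \<and> U \<noteq> {} \<and> U \<subseteq> A"
  then obtain U u where U: "openin mtopology U" "U \<subseteq> A" "u \<in> U" by blast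
  then obtain r where "r > 0" "mball u r \<subseteq> U" "u \<in> M"
    unfolding openin_mtopology by blast
  then show "thick M d A" unfolding thick_def using U centre_in_mball_iff by blast
qed

lemma dense_subset_meets_open:
  assumes "dense_subset M d V" "openin mtopology U" "U \<noteq> {}"
  obtains v where "v \<in> V" "v \<in> U"
proof -
  obtain u where u: "u \<in> U" using assms by blast
  then have "u \<in> mtopology closure_of V"
    using assms openin_subset[OF assms(2)] unfolding dense_subset_def by auto
  then show ?thesis using that assms(2) u unfolding in_closure_of by blast
qed

text \<open>Singletons are closed, so openness survives removing a point; if nothing remained, that
  point would have been isolated.\<close>

lemma open_minus_finite:
  assumes "without_isolated_points M d" "openin mtopology U" "U \<noteq> {}" "finite F"
  shows "openin mtopology (U - F) \<and> U - F \<noteq> {}"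
  using assms(4)
proof (induction F)
  case (insert b F)
  have "openin mtopology (U - F - {b})"
  proof (cases "b \<in> M")
    case True
    then have "closedin mtopology {b}"
      by (simp add: closedin_Hausdorff_sing_eq Hausdorff_space_mtopology)
    then show ?thesis using insert.IH openin_diff by blast
  next
    case False
    then have "U - F - {b} = U - F" using openin_subset[OF assms(2)] by auto
    then show ?thesis using insert.IH by simp
  qed
  moreover have "U - F - {b} \<noteq> {}"
  proof
    assume "U - F - {b} = {}"
    then have "U - F = {b}" using insert.IH by blast
    then show False
      using insert.IH assms(1) openin_subset[of mtopology "{b}"]
      by (auto simp: without_isolated_points_def)
  qed
  moreover have "U - insert b F = U - F - {b}" by blast
  ultimately show ?case by simp
qed (use assms in simp)

text \<open>A point at distance exactly \<open>1\<close> from \<open>b\<close> may have neighbours of \<open>b\<close> arbitrarily close to it;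
  shrinking the open set avoids such points.\<close>

lemma open_decides_unit_balls:
  assumes "openin mtopology U" "U \<noteq> {}" "finite B"
  obtains W where "openin mtopology W" "W \<noteq> {}" "W \<subseteq> U"
    "\<And>b. b \<in> B \<Longrightarrow> W \<subseteq> mball b 1 \<or> W \<inter> mball b 1 = {}"
proof -
  have "\<exists>W. openin mtopology W \<and> W \<noteq> {} \<and> W \<subseteq> U \<and>
      (\<forall>b\<in>B. W \<subseteq> mball b 1 \<or> W \<inter> mball b 1 = {})"
    using assms(3)
  proof (induction B)
    case (insert b B)
    then obtain W where W: "openin mtopology W" "W \<noteq> {}" "W \<subseteq> U"
      "\<forall>b\<in>B. W \<subseteq> mball b 1 \<or> W \<inter> mball b 1 = {}" by blast
    show ?case
    proof (cases "W \<inter> mball b 1 = {}")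
      case False
      then show ?thesis using W by (intro exI[of _ "W \<inter> mball b 1"]) auto
    qed (use W in blast)
  qed (use assms in auto)
  then show ?thesis using that by blast
qed

text \<open>Clause (ii) of geometric existential closedness only speaks of vertices in the unit ball
  of one vertex \<open>s\<close>. The vertices of \<open>B\<close> outside that ball are instead
  kept at distance at least 1 from the new vertex, where clause (i) forbids edges.\<close>

lemma gec_graph_extension:
  assumes gec: "gec_graph M d V E" and thick: "thick M d D"
    and A: "finite A" "A \<subseteq> V" and B: "finite B" "B \<subseteq> V" and disj: "A \<inter> B = {}"
    and D: "\<And>x a. \<lbrakk>x \<in> D; x \<in> M; a \<in> A\<rbrakk> \<Longrightarrow> d x a < 1"
  obtains v where "v \<in> V" "v \<in> D" "v \<notin> A \<union> B" "\<forall>a\<in>A. (v, a) \<in> E" "\<forall>b\<in>B. (v, b) \<notin> E"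
proof -
  have dense: "dense_subset M d V" and VM: "V \<subseteq> M"
    using gec by (auto simp: gec_graph_def dense_subset_def)
  obtain U where "openin mtopology U" "U \<noteq> {}" "U \<subseteq> D"
    using thick thick_iff by auto
  then obtain W where W: "openin mtopology W" "W \<noteq> {}" "W \<subseteq> D"
    and dec: "\<And>b. b \<in> B \<Longrightarrow> W \<subseteq> mball b 1 \<or> W \<inter> mball b 1 = {}"
    using open_decides_unit_balls[OF _ _ B(1)] by (metis order_trans)
  obtain s where s: "s \<in> V" "s \<in> W" using dense_subset_meets_open[OF dense W(1,2)] .
  obtain \<epsilon> where \<epsilon>: "\<epsilon> > 0" "mball s \<epsilon> \<subseteq> W" using W(1) s openin_mtopology by blast
  define B' where "B' = B \<inter> mball s 1"
  have "s \<in> D" "s \<in> M" using s W(3) VM by blast+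
  then have "A \<subseteq> mball s 1"
    using D A(2) VM by (simp add: subset_iff)
  moreover have "finite B'" "B' \<subseteq> V" "A \<inter> B' = {}" "B' \<subseteq> mball s 1"
    using B disj unfolding B'_def by auto
  ultimately obtain v where v: "v \<in> V" "v \<notin> A \<union> B'" "d s v < \<epsilon>"
    "\<forall>a\<in>A. (v, a) \<in> E" "\<forall>b\<in>B'. (v, b) \<notin> E"
    using gec \<epsilon>(1) s(1) A unfolding gec_graph_def by (metis DiffE)
  have vW: "v \<in> W" using v(1,3) \<epsilon>(2) \<open>s \<in> M\<close> VM by (auto simp: subset_iff)
  \<comment> \<open>The set \<open>W\<close> lies inside or outside the unit ball of
    \<open>b\<close>; since \<open>s\<close> is in \<open>W\<close> but not in that ball, all of
    \<open>W\<close> is outside, including \<open>v\<close>.\<close>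
  have far: "v \<notin> mball b 1" if "b \<in> B - B'" for b
  proof -
    have "s \<notin> mball b 1" using that s VM B unfolding B'_def by (auto simp: in_mball commute)
    then show ?thesis using dec[of b] that s vW by blast
  qed
  have "v \<noteq> b \<and> (v, b) \<notin> E" if "b \<in> B - B'" for b
    using far[OF that] that v(1) VM B gec unfolding gec_graph_def
    by (auto simp: in_mball commute subset_iff)
  then show ?thesis using that[of v] v vW W(3) by blast
qed

end

section \<open>Formulas on tuples of points\<close>

locale thickness_definable_space = Metric_space X d
  for X :: "'m list set" and d :: "'m list \<Rightarrow> 'm list \<Rightarrow> real" +
  fixes L :: "('f, 'r) language" and M :: "('f, 'r, 'm) struct" and n :: nat
  assumes no_isolated: "without_isolated_points X d"
    and defining: "defining_structure L M n X d"
    and thickness: "thickness_definable L M n X d"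
begin

lemma length_point: "x \<in> X \<Longrightarrow> length x = n"
  using defining by (auto simp: defining_structure_def tuples_def)

text \<open>Agreement is demanded only on tuples of points of \<open>X\<close>, because
  \<open>X\<close> itself may be definable only with parameters.\<close>

definition point_definable :: "nat \<Rightarrow> ('m list list \<Rightarrow> bool) \<Rightarrow> bool" where
  "point_definable k P \<longleftrightarrow>
     (\<exists>\<phi>. formula_in L (k * n) \<phi> \<and> (\<forall>xs\<in>tuples X k. holds M \<phi> (concat xs) \<longleftrightarrow> P xs))"

lemma point_definable_False: "point_definable k (\<lambda>_. False)"
  unfolding point_definable_def
  by (intro exI[of _ Falsum]) (simp add: formula_in_def holds_def)

lemma point_definable_imp:
  assumes "point_definable k P" "point_definable k Q"
  shows "point_definable k (\<lambda>xs. P xs \<longrightarrow> Q xs)"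
proof -
  obtain \<phi> \<psi> where
    "formula_in L (k * n) \<phi>" "\<forall>xs\<in>tuples X k. holds M \<phi> (concat xs) \<longleftrightarrow> P xs"
    "formula_in L (k * n) \<psi>" "\<forall>xs\<in>tuples X k. holds M \<psi> (concat xs) \<longleftrightarrow> Q xs"
    using assms unfolding point_definable_def by blast
  then show ?thesis unfolding point_definable_def
    by (intro exI[of _ "Imp \<phi> \<psi>"]) (simp add: formula_in_def holds_def)
qed

lemma point_definable_const: "point_definable k (\<lambda>_. b)"
  using point_definable_False[of k] point_definable_imp[of k "\<lambda>_. False" "\<lambda>_. False"]
  by (cases b) auto

lemma point_definable_conj:
  assumes "point_definable k P" "point_definable k Q"
  shows "point_definable k (\<lambda>xs. P xs \<and> Q xs)"
  using point_definable_imp[OF point_definable_imp[OF assms(1)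
      point_definable_imp[OF assms(2) point_definable_False]] point_definable_False]
  by simp

lemma point_definable_Ball:
  assumes "finite A" "\<And>a. a \<in> A \<Longrightarrow> point_definable k (P a)"
  shows "point_definable k (\<lambda>xs. \<forall>a\<in>A. P a xs)"
  using assms
  by (induction A) (auto intro: point_definable_const[where b = True] point_definable_conj)

text \<open>Arguments may be permuted, repeated or dropped. Variable \<open>i\<close> of
  \<open>\<phi>\<close> is coordinate \<open>i mod n\<close> of block \<open>i div n\<close>; the
  renaming \<open>\<rho>\<close> moves it to the same coordinate of block
  \<open>js ! (i div n)\<close>.\<close>

lemma point_definable_select:
  assumes "formula_in L (k * n) \<phi>" "length js = k" "set js \<subseteq> {..<l}"
  shows "point_definable l (\<lambda>xs. holds M \<phi> (concat (map ((!) xs) js)))"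
proof -
  define \<rho> where "\<rho> i = js ! (i div n) * n + i mod n" for i
  obtain \<xi> where \<xi>: "wf_fm L \<xi>" "fv \<xi> \<subseteq> \<rho> ` fv \<phi>"
    "\<And>e. sat M e \<xi> \<longleftrightarrow> sat M (\<lambda>i. e (\<rho> i)) \<phi>"
    using ex_renamed_formula[of L \<phi> \<rho> M] assms(1) unfolding formula_in_def by blast
  have block: "0 < n \<and> i div n < length js \<and> js ! (i div n) < l" if "i \<in> fv \<phi>" for i
  proof -
    \<comment> \<open>If \<open>n = 0\<close> then \<open>\<phi>\<close> has no free variables, so
      the existence of \<open>i\<close> gives \<open>0 < n\<close>.\<close>
    have "i < k * n" using that assms(1) unfolding formula_in_def by auto
    then have "0 < n" "i div n < length js"
      using assms(2) by (auto simp: less_mult_imp_div_less intro: ccontr)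
    then show ?thesis using assms(3) nth_mem by blast
  qed
  have "\<rho> i < l * n" if "i \<in> fv \<phi>" for i
  proof -
    have "\<rho> i < Suc (js ! (i div n)) * n" using block[OF that] by (simp add: \<rho>_def)
    also have "\<dots> \<le> l * n" using block[OF that] by (intro mult_right_mono) auto
    finally show ?thesis .
  qed
  then have "formula_in L (l * n) \<xi>" using \<xi> unfolding formula_in_def by auto
  moreover have "holds M \<xi> (concat xs) \<longleftrightarrow> holds M \<phi> (concat (map ((!) xs) js))"
    if xs: "xs \<in> tuples X l" for xs
  proof -
    have uni: "\<forall>x\<in>set xs. length x = n" and len: "length xs = l"
      using xs length_point by (auto simp: tuples_def)
    have "concat xs ! \<rho> i = concat (map ((!) xs) js) ! i" if "i \<in> fv \<phi>" for i
    proof -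
      note b = block[OF that]
      have "concat xs ! \<rho> i = xs ! (js ! (i div n)) ! (i mod n)"
        unfolding \<rho>_def by (rule nth_concat_uniform) (use uni len b in auto)
      moreover have "concat (map ((!) xs) js) ! (i div n * n + i mod n)
          = map ((!) xs) js ! (i div n) ! (i mod n)"
        by (rule nth_concat_uniform) (use uni len b assms(3) in auto)
      ultimately show ?thesis using b by simp
    qed
    then show ?thesis unfolding holds_def \<xi>(3) by (intro sat_cong)
  qed
  ultimately show ?thesis unfolding point_definable_def by blast
qed

lemma point_definable_dist:
  assumes "i < l" "j < l"
  shows "point_definable l (\<lambda>xs. d (xs ! i) (xs ! j) < 1)"
proof -
  \<comment> \<open>Over the empty parameter set the list of parameters is empty, so no further
    variables occur.\<close>
  obtain \<phi> where \<phi>: "formula_in L (2 * n) \<phi>"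
    "{x @ y | x y. x \<in> X \<and> y \<in> X \<and> d x y < 1} = {xs \<in> tuples (univ M) (2 * n). holds M \<phi> xs}"
    using defining unfolding defining_structure_def definable_def
    by (auto simp: tuples_def)
  have "holds M \<phi> (x @ y) \<longleftrightarrow> d x y < 1" if "x \<in> X" "y \<in> X" for x y
  proof -
    have "x @ y \<in> tuples (univ M) (2 * n)"
      using that defining by (auto simp: defining_structure_def tuples_def subset_iff)
    then have "holds M \<phi> (x @ y) \<longleftrightarrow> x @ y \<in> {x @ y | x y. x \<in> X \<and> y \<in> X \<and> d x y < 1}"
      using \<phi>(2) by simp
    \<comment> \<open>All points have length \<open>n\<close>, so a concatenation determines its two
      halves.\<close>
    also have "\<dots> \<longleftrightarrow> d x y < 1"
      using that by (auto simp: length_point)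
    finally show ?thesis .
  qed
  moreover have "point_definable l (\<lambda>xs. holds M \<phi> (concat (map ((!) xs) [i, j])))"
    by (rule point_definable_select) (use \<phi>(1) assms in \<open>auto simp: mult_2\<close>)
  ultimately show ?thesis
    unfolding point_definable_def using assms by (auto simp: tuples_def subset_iff)
qed

section \<open>Uniform quantifier-free definability\<close>

text \<open>The flag \<open>g\<close> distinguishes graphs from bare vertex sets, so that both quantifier
  elimination results come from one argument.\<close>

definition ind_lang :: "bool \<Rightarrow> (unit, ('f, 'r) ind_sym) language" where
  "ind_lang g = (if g then L_ind_E L n else L_ind L n)"

definition admissible :: "bool \<Rightarrow> 'm list set \<Rightarrow> ('m list \<times> 'm list) set \<Rightarrow> bool" where
  "admissible g V E \<longleftrightarrow> independent_set L M n X d V \<and> dense_subset X d V \<and>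
     (if g then gec_graph X d V E else E = {})"

text \<open>One formula \<open>\<psi>\<close> must serve all admissible \<open>V\<close> and
  \<open>E\<close> at once; this uniformity is what later yields elementary equivalence of two
  different graphs.\<close>

definition qf_definable ::
    "bool \<Rightarrow> nat set \<Rightarrow>
      ('m list set \<Rightarrow> ('m list \<times> 'm list) set \<Rightarrow> (nat \<Rightarrow> 'm list) \<Rightarrow> bool) \<Rightarrow> bool" where
  "qf_definable g I P \<longleftrightarrow>
     (\<exists>\<psi>. wf_fm (ind_lang g) \<psi> \<and> quantifier_free \<psi> \<and> fv \<psi> \<subseteq> I \<and>
       (\<forall>V E e. admissible g V E \<longrightarrow> e ` I \<subseteq> V \<longrightarrow> (sat (G_ind M V E) e \<psi> \<longleftrightarrow> P V E e)))"

lemma fun_syms_ind_lang [simp]: "fun_syms (ind_lang g) = {}"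
  by (simp add: ind_lang_def L_ind_def L_ind_E_def relational_lang_def)

lemma rel_arity_ind_lang [simp]: "rel_arity (ind_lang g) = ind_arity"
  by (simp add: ind_lang_def L_ind_def L_ind_E_def relational_lang_def)

lemma R_in_ind_lang [simp]: "R \<phi> k \<in> rel_syms (ind_lang g) \<longleftrightarrow> formula_in L (k * n) \<phi>"
  by (auto simp: ind_lang_def L_ind_def L_ind_E_def relational_lang_def)

lemma Edge_in_ind_lang [simp]: "Edge \<in> rel_syms (ind_lang g) \<longleftrightarrow> g"
  by (auto simp: ind_lang_def L_ind_def L_ind_E_def relational_lang_def)

lemma univ_G_ind [simp]: "univ (G_ind M V E) = V"
  by (simp add: G_ind_def)

lemma rel_int_G_ind [simp]: "rel_int (G_ind M V E) = ind_rel M V E"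
  by (simp add: G_ind_def)

lemma wf_tm_ind_lang: "wf_tm (ind_lang g) t \<Longrightarrow> \<exists>i. t = Var i"
  by (cases t) auto

lemma wf_tms_ind_lang:
  assumes "\<forall>t\<in>set ts. wf_tm (ind_lang g) t"
  obtains ks where "ts = map Var ks"
proof -
  have "\<exists>ks. ts = map Var ks" using assms
  proof (induction ts)
    case (Cons t ts)
    then show ?case using wf_tm_ind_lang by (metis list.set_intros list.simps(9))
  qed simp
  then show ?thesis using that by blast
qed

lemma wf_fm_ind_lang_cases:
  assumes "wf_fm (ind_lang g) (Rel r ts)"
  obtains (R) \<phi> ks where "r = R \<phi> (length ks)" "ts = map Var ks" "formula_in L (length ks * n) \<phi>"
  | (Edge) i j where "g" "r = Edge" "ts = [Var i, Var j]"
proof -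
  obtain ks where ks: "ts = map Var ks" using assms wf_tms_ind_lang[of ts g] by auto
  show ?thesis
  proof (cases r)
    case (R \<phi> k)
    then show ?thesis using that(1)[of \<phi> ks] assms ks by auto
  next
    case Edge
    then have "length ks = 2" using assms ks by simp
    then obtain i j where "ks = [i, j]"
      by (metis (no_types, lifting) One_nat_def Suc_1 length_0_conv length_Suc_conv)
    then show ?thesis using that(2)[of i j] Edge assms ks by simp
  qed
qed

lemma admissible_subset: "admissible g V E \<Longrightarrow> V \<subseteq> X"
  by (simp add: admissible_def dense_subset_def)

lemma qf_definableI:
  assumes "wf_fm (ind_lang g) \<psi>" "quantifier_free \<psi>" "fv \<psi> \<subseteq> I"
    "\<And>V E e. \<lbrakk>admissible g V E; e ` I \<subseteq> V\<rbrakk> \<Longrightarrow> sat (G_ind M V E) e \<psi> \<longleftrightarrow> P V E e"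
  shows "qf_definable g I P"
  unfolding qf_definable_def using assms by blast

lemma qf_definable_cong:
  assumes "qf_definable g I P"
    "\<And>V E e. \<lbrakk>admissible g V E; e ` I \<subseteq> V\<rbrakk> \<Longrightarrow> P V E e \<longleftrightarrow> Q V E e"
  shows "qf_definable g I Q"
  using assms unfolding qf_definable_def by (meson)

lemma qf_definable_False: "qf_definable g I (\<lambda>V E e. False)"
  by (rule qf_definableI[of g Falsum]) auto

lemma qf_definable_imp:
  assumes "qf_definable g I P" "qf_definable g I Q"
  shows "qf_definable g I (\<lambda>V E e. P V E e \<longrightarrow> Q V E e)"
proof -
  obtain \<phi> \<psi> where
    "wf_fm (ind_lang g) \<phi> \<and> quantifier_free \<phi> \<and> fv \<phi> \<subseteq> I \<and>
      (\<forall>V E e. admissible g V E \<longrightarrow> e ` I \<subseteq> V \<longrightarrow> (sat (G_ind M V E) e \<phi> \<longleftrightarrow> P V E e))"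
    "wf_fm (ind_lang g) \<psi> \<and> quantifier_free \<psi> \<and> fv \<psi> \<subseteq> I \<and>
      (\<forall>V E e. admissible g V E \<longrightarrow> e ` I \<subseteq> V \<longrightarrow> (sat (G_ind M V E) e \<psi> \<longleftrightarrow> Q V E e))"
    using assms unfolding qf_definable_def by metis
  then show ?thesis by (intro qf_definableI[of g "Imp \<phi> \<psi>"]) auto
qed

lemma qf_definable_not:
  "qf_definable g I P \<Longrightarrow> qf_definable g I (\<lambda>V E e. \<not> P V E e)"
  using qf_definable_imp[OF _ qf_definable_False] by simp

lemma qf_definable_const: "qf_definable g I (\<lambda>V E e. b)"
  using qf_definable_False qf_definable_not[OF qf_definable_False] by (cases b) auto

lemma qf_definable_conj:
  assumes "qf_definable g I P" "qf_definable g I Q"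
  shows "qf_definable g I (\<lambda>V E e. P V E e \<and> Q V E e)"
  using qf_definable_not[OF qf_definable_imp[OF assms(1) qf_definable_not[OF assms(2)]]] by simp

lemma qf_definable_disj:
  assumes "qf_definable g I P" "qf_definable g I Q"
  shows "qf_definable g I (\<lambda>V E e. P V E e \<or> Q V E e)"
  using qf_definable_imp[OF qf_definable_not[OF assms(1)] assms(2)] by (simp add: imp_conv_disj)

lemma qf_definable_iff_const:
  assumes "qf_definable g I P"
  shows "qf_definable g I (\<lambda>V E e. P V E e \<longleftrightarrow> b)"
  using assms qf_definable_not[OF assms] by (cases b) auto

lemma qf_definable_Ball:
  assumes "finite A" "\<And>a. a \<in> A \<Longrightarrow> qf_definable g I (P a)"
  shows "qf_definable g I (\<lambda>V E e. \<forall>a\<in>A. P a V E e)"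
  using assms
  by (induction A) (auto intro: qf_definable_const[where b = True] qf_definable_conj)

lemma qf_definable_Bex:
  assumes "finite A" "\<And>a. a \<in> A \<Longrightarrow> qf_definable g I (P a)"
  shows "qf_definable g I (\<lambda>V E e. \<exists>a\<in>A. P a V E e)"
  using assms
  by (induction A) (auto intro: qf_definable_False qf_definable_disj)

lemma qf_definable_eq:
  "\<lbrakk>i \<in> I; j \<in> I\<rbrakk> \<Longrightarrow> qf_definable g I (\<lambda>V E e. e i = e j)"
  by (rule qf_definableI[of g "Eq (Var i) (Var j)"]) auto

lemma qf_definable_edge:
  assumes "i \<in> I" "j \<in> I"
  shows "qf_definable g I (\<lambda>V E e. (e i, e j) \<in> E)"
proof (cases g)
  case True
  then show ?thesis using assms
    by (intro qf_definableI[of g "Rel Edge [Var i, Var j]"]) auto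
next
  case False
  \<comment> \<open>Here \<open>Edge\<close> is not in the language, but \<open>E\<close> is empty,
    so \<open>Falsum\<close> serves.\<close>
  then show ?thesis
    by (intro qf_definable_cong[OF qf_definable_False]) (auto simp: admissible_def)
qed

lemma qf_definable_holds:
  assumes "formula_in L (length ks * n) \<phi>" "set ks \<subseteq> I"
  shows "qf_definable g I (\<lambda>V E e. holds M \<phi> (concat (map e ks)))"
  by (rule qf_definableI[of g "Rel (R \<phi> (length ks)) (map Var ks)"])
    (use assms in \<open>auto simp: tuples_def comp_def\<close>)

text \<open>Needed when the witness for \<open>x\<close> is one of the given entries. The atoms are
  treated one by one, with \<open>\<sigma>\<close> replacing \<open>x\<close> by \<open>i\<close>,
  because \<open>ex_renamed_formula\<close> does not record that its result is
  quantifier-free.\<close>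

lemma qf_definable_substitute:
  assumes "wf_fm (ind_lang g) \<theta>" "quantifier_free \<theta>" "fv \<theta> \<subseteq> insert x I" "i \<in> I"
  shows "qf_definable g I (\<lambda>V E e. sat (G_ind M V E) (e(x := e i)) \<theta>)"
  using assms(1-3)
proof (induction \<theta>)
  case Falsum
  then show ?case by (simp add: qf_definable_False)
next
  case (Eq s t)
  then obtain j k where st: "s = Var j" "t = Var k" using wf_tm_ind_lang by (metis wf_fm.simps(2))
  define \<sigma> where "\<sigma> k = (if k = x then i else k)" for k
  have "qf_definable g I (\<lambda>V E e. e (\<sigma> j) = e (\<sigma> k))"
    by (rule qf_definable_eq) (use Eq st assms(4) in \<open>auto simp: \<sigma>_def\<close>)
  then show ?case by (rule qf_definable_cong) (auto simp: st \<sigma>_def)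
next
  case (Rel r ts)
  define \<sigma> where "\<sigma> k = (if k = x then i else k)" for k
  have upd: "e(x := e i) = e \<circ> \<sigma>" for e :: "nat \<Rightarrow> 'm list" by (auto simp: \<sigma>_def)
  from Rel(1) show ?case
  proof (cases rule: wf_fm_ind_lang_cases)
    case (R \<phi> ks)
    have ks: "set (map \<sigma> ks) \<subseteq> I" using Rel R assms(4) by (auto simp: \<sigma>_def)
    have "qf_definable g I (\<lambda>V E e. holds M \<phi> (concat (map e (map \<sigma> ks))))"
      by (rule qf_definable_holds) (use ks R in auto)
    then show ?thesis
      by (rule qf_definable_cong) (use ks R in \<open>auto simp: upd tuples_def comp_def\<close>)
  next
    case (Edge j k)
    have "qf_definable g I (\<lambda>V E e. (e (\<sigma> j), e (\<sigma> k)) \<in> E)"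
      by (rule qf_definable_edge) (use Rel Edge assms(4) in \<open>auto simp: \<sigma>_def\<close>)
    then show ?thesis by (rule qf_definable_cong) (use Edge in \<open>auto simp: upd\<close>)
  qed
next
  case (Imp \<phi> \<psi>)
  then show ?case using qf_definable_imp by simp
qed simp

section \<open>Elimination of one quantifier\<close>

text \<open>This is the quantifier-free type of the tuple in the graph language with equality, coded
  on indices. For finite \<open>J\<close> only finitely many restrictions of \<open>T\<close> and
  \<open>Q\<close> to \<open>J\<close> matter, so one can take a disjunction over them.\<close>

definition diagram ::
    "('m list \<times> 'm list) set \<Rightarrow> nat set \<Rightarrow> (nat \<Rightarrow> 'm list) \<Rightarrow>
      (nat \<times> nat) set \<Rightarrow> (nat \<times> nat) set \<Rightarrow> bool" where
  "diagram E J e T Q \<longleftrightarrow>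
     (\<forall>i\<in>J. \<forall>j\<in>J. ((e i, e j) \<in> E \<longleftrightarrow> (i, j) \<in> T) \<and> (e i = e j \<longleftrightarrow> (i, j) \<in> Q))"

lemma qf_definable_diagram:
  assumes "finite I"
  shows "qf_definable g I (\<lambda>V E e. diagram E I e T Q)"
  unfolding diagram_def
  by (intro qf_definable_Ball qf_definable_conj qf_definable_iff_const qf_definable_edge
      qf_definable_eq assms)

text \<open>Once the diagram of its variables is fixed, a quantifier-free formula is a formula about
  points of \<open>X\<close>.\<close>

lemma translate_along_diagram:
  assumes "wf_fm (ind_lang g) \<theta>" "quantifier_free \<theta>" "fv \<theta> \<subseteq> set js"
  obtains \<xi> where "formula_in L (length js * n) \<xi>"
    "\<And>V E e. \<lbrakk>admissible g V E; e ` set js \<subseteq> V; diagram E (set js) e T Q\<rbrakk> \<Longrightarrow>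
       sat (G_ind M V E) e \<theta> \<longleftrightarrow> holds M \<xi> (concat (map e js))"
proof -
  have tup: "map e js \<in> tuples X (length js)"
    if "admissible g V E" "e ` set js \<subseteq> V" for e :: "nat \<Rightarrow> 'm list" and V E
    using that admissible_subset[OF that(1)] by (auto simp: tuples_def)
  have "\<exists>P. point_definable (length js) P \<and> (\<forall>V E e. admissible g V E \<longrightarrow> e ` set js \<subseteq> V \<longrightarrow>
      diagram E (set js) e T Q \<longrightarrow> (sat (G_ind M V E) e \<theta> \<longleftrightarrow> P (map e js)))"
    using assms
  proof (induction \<theta>)
    case Falsum
    show ?case using point_definable_False by fastforce
  next
    case (Eq s t)
    then obtain j k where st: "s = Var j" "t = Var k"
      using wf_tm_ind_lang by (metis wf_fm.simps(2))
    show ?case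
      by (intro exI[of _ "\<lambda>_. (j, k) \<in> Q"])
        (use Eq st in \<open>auto simp: diagram_def point_definable_const\<close>)
  next
    case (Rel r ts)
    from Rel(1) show ?case
    proof (cases rule: wf_fm_ind_lang_cases)
      case (R \<phi> ks)
      then have sub: "set ks \<subseteq> set js" using Rel by auto
      \<comment> \<open>The list \<open>js\<close> may contain repetitions, so some position of
        \<open>k\<close> is chosen.\<close>
      define pos where "pos k = (SOME p. p < length js \<and> js ! p = k)" for k
      have pos: "pos k < length js" "js ! pos k = k" if "k \<in> set ks" for k
        using someI_ex[of "\<lambda>p. p < length js \<and> js ! p = k"] that sub
        unfolding pos_def by (auto simp: in_set_conv_nth subset_iff)
      have sel: "map ((!) (map e js)) (map pos ks) = map e ks" for e :: "nat \<Rightarrow> 'm list"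
        using pos by auto
      have vars: "map (tm_val (G_ind M V E) e) (map Var ks) = map e ks" for V E e
        by simp
      have "point_definable (length js)
          (\<lambda>xs. holds M \<phi> (concat (map ((!) xs) (map pos ks))))"
        by (rule point_definable_select) (use R pos in auto)
      then show ?thesis
        by (intro exI[of _ "\<lambda>xs. holds M \<phi> (concat (map ((!) xs) (map pos ks)))"])
          (use R sub vars sel in \<open>auto simp: tuples_def image_subset_iff subset_iff simp del: map_map map_eq_conv\<close>)
    next
      case (Edge j k)
      then show ?thesis
        by (intro exI[of _ "\<lambda>_. (j, k) \<in> T"])
          (use Rel in \<open>auto simp: diagram_def point_definable_const\<close>)
    qed
  next
    case (Imp \<phi> \<psi>)
    then obtain P1 P2 where
      "point_definable (length js) P1 \<and> (\<forall>V E e. admissible g V E \<longrightarrow> e ` set js \<subseteq> V \<longrightarrow>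
        diagram E (set js) e T Q \<longrightarrow> (sat (G_ind M V E) e \<phi> \<longleftrightarrow> P1 (map e js)))"
      "point_definable (length js) P2 \<and> (\<forall>V E e. admissible g V E \<longrightarrow> e ` set js \<subseteq> V \<longrightarrow>
        diagram E (set js) e T Q \<longrightarrow> (sat (G_ind M V E) e \<psi> \<longleftrightarrow> P2 (map e js)))"
      by auto
    then show ?case
      by (intro exI[of _ "\<lambda>xs. P1 xs \<longrightarrow> P2 xs"]) (simp add: point_definable_imp)
  qed simp
  then show ?thesis using that tup unfolding point_definable_def by metis
qed

text \<open>With edges this is \<open>gec_graph_extension\<close>. Without them only avoidance of
  the finite set \<open>B\<close> remains, which density achieves because there are no isolated
  points.\<close>

lemma admissible_extension:
  assumes "admissible g V E" "thick X d D" "finite A" "A \<subseteq> V" "finite B" "B \<subseteq> V" "A \<inter> B = {}"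
    "\<not> g \<Longrightarrow> A = {}" "\<And>x a. \<lbrakk>x \<in> D; x \<in> X; a \<in> A\<rbrakk> \<Longrightarrow> d x a < 1"
  obtains v where "v \<in> V" "v \<in> D" "v \<notin> A \<union> B" "\<forall>a\<in>A. (v, a) \<in> E" "\<forall>b\<in>B. (v, b) \<notin> E"
proof (cases g)
  case True
  then have "gec_graph X d V E" using assms(1) by (simp add: admissible_def)
  from gec_graph_extension[OF this assms(2-7,9)] that show ?thesis by blast
next
  case False
  obtain U where U: "openin mtopology U" "U \<noteq> {}" "U \<subseteq> D" using assms(2) thick_iff by auto
  have dense: "dense_subset X d V" using assms(1) by (simp add: admissible_def)
  obtain v where "v \<in> V" "v \<in> U - B"
    using open_minus_finite[OF no_isolated U(1,2) assms(5)] dense_subset_meets_open[OF dense] by metis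
  then show ?thesis using that[of v] False assms U by (auto simp: admissible_def)
qed

lemma admissible_edge:
  assumes "admissible g V E"
  shows "sym E" "irrefl E" "(u, v) \<in> E \<Longrightarrow> d u v < 1"
  using assms by (auto simp: admissible_def gec_graph_def simple_graph_def sym_def irrefl_def
      split: if_splits)

text \<open>By independence, a new point satisfying \<open>\<theta>\<close> with neighbours \<open>S\<close> lies in a thick set;
  conversely a thick set contains such a point by \<open>admissible_extension\<close>.\<close>

lemma ex_new_point_iff_thick:
  assumes \<theta>: "wf_fm (ind_lang g) \<theta>" "quantifier_free \<theta>" "fv \<theta> \<subseteq> insert x (set js)"
    and x: "x \<notin> set js" and S: "S \<subseteq> set js" "\<not> g \<Longrightarrow> S = {}"
    and T: "T \<subseteq> set js \<times> set js" and Q: "Q \<subseteq> set js \<times> set js"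
    and compat: "\<And>i j. (i, j) \<in> Q \<Longrightarrow> i \<in> S \<longleftrightarrow> j \<in> S"
  obtains \<psi> where "formula_in L (length js * n) \<psi>"
    "\<And>V E e. \<lbrakk>admissible g V E; e ` set js \<subseteq> V; diagram E (set js) e T Q\<rbrakk> \<Longrightarrow>
       holds M \<psi> (concat (map e js)) \<longleftrightarrow>
       (\<exists>a\<in>V - e ` set js. (\<forall>i\<in>set js. (a, e i) \<in> E \<longleftrightarrow> i \<in> S) \<and> sat (G_ind M V E) (e(x := a)) \<theta>)"
proof -
  let ?I = "set js" and ?m = "length js"
  \<comment> \<open>\<open>T'\<close> and \<open>Q'\<close> describe the tuple extended by a new
    point at \<open>x\<close>: distinct from all entries and adjacent, in both directions, exactly
    to those with index in \<open>S\<close>.\<close>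
  define T' where "T' = T \<union> {x} \<times> S \<union> S \<times> {x}"
  define Q' where "Q' = insert (x, x) Q"
  obtain \<xi> where \<xi>: "formula_in L (Suc ?m * n) \<xi>"
    "\<And>V E e. \<lbrakk>admissible g V E; e ` insert x ?I \<subseteq> V; diagram E (insert x ?I) e T' Q'\<rbrakk> \<Longrightarrow>
       sat (G_ind M V E) e \<theta> \<longleftrightarrow> holds M \<xi> (concat (map e (x # js)))"
    using translate_along_diagram[of g \<theta> "x # js" T' Q'] \<theta> by auto
  \<comment> \<open>Adjacency forces distance below 1, so this condition is added for all intended
    neighbours. The new point is entry 0, hence the shift to \<open>Suc p\<close>.\<close>
  have "point_definable (Suc ?m) (\<lambda>xs. holds M \<xi> (concat xs) \<and>
      (\<forall>p\<in>{p. p < ?m \<and> js ! p \<in> S}. d (xs ! 0) (xs ! Suc p) < 1))"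
    by (intro point_definable_conj point_definable_Ball point_definable_dist)
      (use \<xi>(1) in \<open>auto simp: point_definable_def\<close>)
  then obtain \<eta> where \<eta>: "formula_in L (Suc ?m * n) \<eta>"
    "\<And>xs. xs \<in> tuples X (Suc ?m) \<Longrightarrow> holds M \<eta> (concat xs) \<longleftrightarrow> holds M \<xi> (concat xs) \<and>
      (\<forall>p\<in>{p. p < ?m \<and> js ! p \<in> S}. d (xs ! 0) (xs ! Suc p) < 1)"
    unfolding point_definable_def by blast
  \<comment> \<open>Definability of thickness treats the first block as the varying point and the
    rest as parameters; this is why \<open>x\<close> heads the list \<open>x # js\<close>.\<close>
  have \<eta>n: "formula_in L (n + ?m * n) \<eta>" using \<eta>(1) by simp
  then obtain \<psi> where \<psi>: "formula_in L (?m * n) \<psi>"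
    "\<And>bs. bs \<in> tuples X ?m \<Longrightarrow> holds M \<psi> (concat bs) \<longleftrightarrow> thick X d (solution_set M X \<eta> bs)"
    using thickness unfolding thickness_definable_def by blast
  have "holds M \<psi> (concat (map e js)) \<longleftrightarrow>
      (\<exists>a\<in>V - e ` ?I. (\<forall>i\<in>?I. (a, e i) \<in> E \<longleftrightarrow> i \<in> S) \<and> sat (G_ind M V E) (e(x := a)) \<theta>)"
    if adm: "admissible g V E" and e: "e ` ?I \<subseteq> V" and diag: "diagram E ?I e T Q" for V E e
  proof -
    note edge = admissible_edge[OF adm] and VX = admissible_subset[OF adm]
    let ?bs = "map e js"
    define D where "D = solution_set M X \<eta> ?bs"
    have bs: "?bs \<in> tuples V ?m" "?bs \<in> tuples X ?m" using e VX by (auto simp: tuples_def)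
    have D: "a \<in> D \<longleftrightarrow> a \<in> X \<and> holds M \<xi> (a @ concat ?bs) \<and> (\<forall>i\<in>S. d a (e i) < 1)" for a
    proof (cases "a \<in> X")
      case True
      then have "a # ?bs \<in> tuples X (Suc ?m)" using bs by (simp add: tuples_def)
      from \<eta>(2)[OF this] True S(1) show ?thesis
        unfolding D_def solution_set_def by (auto simp: subset_iff in_set_conv_nth)
    qed (simp add: D_def solution_set_def)
    have new: "sat (G_ind M V E) (e(x := a)) \<theta> \<longleftrightarrow> holds M \<xi> (a @ concat ?bs)"
      if a: "a \<in> V" "a \<notin> e ` ?I" "\<forall>i\<in>?I. (a, e i) \<in> E \<longleftrightarrow> i \<in> S" for a
    proof -
      have nb: "(a, e i) \<in> E \<longleftrightarrow> i \<in> S" "(e i, a) \<in> E \<longleftrightarrow> i \<in> S" "a \<noteq> e i" if "i \<in> ?I" for i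
        using that a edge(1) by (auto dest: symD)
      have loop: "(a, a) \<notin> E" using edge(2) by (simp add: irrefl_def)
      have old: "(i, j) \<in> T' \<longleftrightarrow> (i, j) \<in> T" "(i, j) \<in> Q' \<longleftrightarrow> (i, j) \<in> Q"
        if "i \<noteq> x" "j \<noteq> x" for i j
        using that by (simp_all add: T'_def Q'_def)
      have with_x: "(x, i) \<in> T' \<longleftrightarrow> i \<in> S" "(i, x) \<in> T' \<longleftrightarrow> i \<in> S"
        "(x, i) \<notin> Q'" "(i, x) \<notin> Q'" if "i \<in> ?I" for i
        using that x S(1) T Q by (auto simp: T'_def Q'_def)
      have diag_x: "(x, x) \<notin> T'" "(x, x) \<in> Q'"
        using x S(1) T by (auto simp: T'_def Q'_def)
      have "diagram E (insert x ?I) (e(x := a)) T' Q'"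
        unfolding diagram_def
      proof (intro ballI)
        fix i j assume ij: "i \<in> insert x ?I" "j \<in> insert x ?I"
        show "((((e(x := a)) i, (e(x := a)) j) \<in> E) \<longleftrightarrow> (i, j) \<in> T') \<and>
            ((e(x := a)) i = (e(x := a)) j \<longleftrightarrow> (i, j) \<in> Q')"
        proof (cases "i = x \<or> j = x")
          case True
          then show ?thesis
            using ij nb nb(3)[symmetric] loop with_x diag_x by (cases "i = x"; cases "j = x") simp_all
        next
          case False
          then show ?thesis using ij diag old[of i j] by (simp add: diagram_def)
        qed
      qed
      moreover have "(e(x := a)) ` insert x ?I \<subseteq> V" using a e by auto
      moreover have "map (e(x := a)) (x # js) = a # ?bs" using x by auto
      ultimately show ?thesis using \<xi>(2)[OF adm] by (metis concat.simps(2))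
    qed
    have "thick X d D \<longleftrightarrow>
      (\<exists>a\<in>V - e ` ?I. (\<forall>i\<in>?I. (a, e i) \<in> E \<longleftrightarrow> i \<in> S) \<and> sat (G_ind M V E) (e(x := a)) \<theta>)"
    proof
      assume thick: "thick X d D"
      \<comment> \<open>Two indices may name the same vertex; \<open>compat\<close> excludes that
        only one of them is in \<open>S\<close>.\<close>
      have disj: "e ` S \<inter> e ` (?I - S) = {}"
        using diag compat S(1) unfolding diagram_def by (auto simp: image_iff)
      obtain v where v: "v \<in> V" "v \<in> D" "v \<notin> e ` S \<union> e ` (?I - S)"
        "\<forall>a\<in>e ` S. (v, a) \<in> E" "\<forall>b\<in>e ` (?I - S). (v, b) \<notin> E"
        by (rule admissible_extension[OF adm thick, of "e ` S" "e ` (?I - S)"])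
          (use e S disj D finite_subset[OF S(1)] in auto)
      have v_new: "v \<in> V" "v \<notin> e ` ?I" "\<forall>i\<in>?I. (v, e i) \<in> E \<longleftrightarrow> i \<in> S"
        using v S(1) by auto
      then show "\<exists>a\<in>V - e ` ?I. (\<forall>i\<in>?I. (a, e i) \<in> E \<longleftrightarrow> i \<in> S) \<and>
          sat (G_ind M V E) (e(x := a)) \<theta>"
        using new[OF v_new] v(2) D by blast
    next
      assume "\<exists>a\<in>V - e ` ?I. (\<forall>i\<in>?I. (a, e i) \<in> E \<longleftrightarrow> i \<in> S) \<and>
          sat (G_ind M V E) (e(x := a)) \<theta>"
      then obtain a where a: "a \<in> V" "a \<notin> e ` ?I" "\<forall>i\<in>?I. (a, e i) \<in> E \<longleftrightarrow> i \<in> S"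
        "sat (G_ind M V E) (e(x := a)) \<theta>" by blast
      \<comment> \<open>Neighbours are at distance below 1, so \<open>a\<close> satisfies both parts
        of \<open>\<eta>\<close>. Were \<open>D\<close> thin, independence would force
        \<open>a\<close> to be one of the parameters.\<close>
      have "a \<in> D" using new[OF a(1-3)] a VX S(1) edge(3) by (auto simp: D)
      moreover have "independent_set L M n X d V" using adm by (simp add: admissible_def)
      ultimately show "thick X d D"
        using \<eta>n bs(1) a(1,2) unfolding independent_set_def D_def by fastforce
    qed
    then show ?thesis using \<psi>(2)[OF bs(2)] by (simp add: D_def)
  qed
  then show ?thesis using that \<psi>(1) by blast
qed

text \<open>A witness is either an entry of the tuple, found by substitution, or new. In the second
  case a finite disjunction runs over the neighbours \<open>S\<close> of the witness and the diagram
  of the tuple, and each disjunct is that diagram together with one condition on thickness.\<close>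

lemma qf_definable_ex:
  assumes \<theta>: "wf_fm (ind_lang g) \<theta>" "quantifier_free \<theta>" "fv \<theta> \<subseteq> insert x I"
    and I: "finite I" "x \<notin> I"
  shows "qf_definable g I (\<lambda>V E e. \<exists>a\<in>V. sat (G_ind M V E) (e(x := a)) \<theta>)"
proof -
  obtain js where js: "set js = I" using I(1) finite_list by blast
  \<comment> \<open>Without edges the only neighbour pattern is the empty one; \<open>eqs S\<close>
    discards equality patterns that would identify a neighbour with a non-neighbour.\<close>
  define pats where "pats = (if g then Pow I else {{}})"
  define eqs where "eqs S = {Q \<in> Pow (I \<times> I). \<forall>(i, j)\<in>Q. i \<in> S \<longleftrightarrow> j \<in> S}" for S
  have fin: "finite pats" "finite (Pow (I \<times> I))" "finite (eqs S)" for S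
    using I by (auto simp: pats_def eqs_def)
  define new where "new V E e S \<longleftrightarrow> (\<exists>a\<in>V - e ` I. (\<forall>i\<in>I. (a, e i) \<in> E \<longleftrightarrow> i \<in> S) \<and>
      sat (G_ind M V E) (e(x := a)) \<theta>)" for V E e S
  have pattern: "qf_definable g I (\<lambda>V E e. diagram E I e T Q \<and> new V E e S)"
    if "S \<in> pats" "T \<in> Pow (I \<times> I)" "Q \<in> eqs S" for S T Q
  proof -
    have "S \<subseteq> set js" "\<not> g \<Longrightarrow> S = {}" "T \<subseteq> set js \<times> set js" "Q \<subseteq> set js \<times> set js"
      "\<And>i j. (i, j) \<in> Q \<Longrightarrow> i \<in> S \<longleftrightarrow> j \<in> S"
      using that js unfolding pats_def eqs_def by (auto split: if_splits)
    from ex_new_point_iff_thick[OF \<theta>[folded js] I(2)[folded js] this]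
    obtain \<psi> where \<psi>: "formula_in L (length js * n) \<psi>"
      "\<And>V E e. \<lbrakk>admissible g V E; e ` I \<subseteq> V; diagram E I e T Q\<rbrakk> \<Longrightarrow>
         holds M \<psi> (concat (map e js)) \<longleftrightarrow> new V E e S"
      unfolding new_def js by metis
    have "qf_definable g I (\<lambda>V E e. diagram E I e T Q \<and> holds M \<psi> (concat (map e js)))"
      by (intro qf_definable_conj qf_definable_diagram qf_definable_holds) (use I \<psi> js in auto)
    then show ?thesis by (rule qf_definable_cong) (use \<psi>(2) in blast)
  qed
  have "qf_definable g I (\<lambda>V E e. (\<exists>i\<in>I. sat (G_ind M V E) (e(x := e i)) \<theta>) \<or>
      (\<exists>S\<in>pats. \<exists>T\<in>Pow (I \<times> I). \<exists>Q\<in>eqs S. diagram E I e T Q \<and> new V E e S))"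
    by (intro qf_definable_disj qf_definable_Bex qf_definable_substitute pattern fin \<theta> I)
  then show ?thesis
  proof (rule qf_definable_cong)
    fix V E and e :: "nat \<Rightarrow> 'm list"
    assume adm: "admissible g V E" and e: "e ` I \<subseteq> V"
    show "(\<exists>i\<in>I. sat (G_ind M V E) (e(x := e i)) \<theta>) \<or>
        (\<exists>S\<in>pats. \<exists>T\<in>Pow (I \<times> I). \<exists>Q\<in>eqs S. diagram E I e T Q \<and> new V E e S) \<longleftrightarrow>
      (\<exists>a\<in>V. sat (G_ind M V E) (e(x := a)) \<theta>)" (is "?old \<or> ?new \<longleftrightarrow> ?ex")
    proof
      assume "?old \<or> ?new"
      then show ?ex using e unfolding new_def by blast
    next
      assume ?ex
      then obtain a where a: "a \<in> V" "sat (G_ind M V E) (e(x := a)) \<theta>" by blast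
      show "?old \<or> ?new"
      proof (cases "a \<in> e ` I")
        case True
        then show ?thesis using a by blast
      next
        case False
        define S where "S = {i \<in> I. (a, e i) \<in> E}"
        define T where "T = {(i, j) \<in> I \<times> I. (e i, e j) \<in> E}"
        define Q where "Q = {(i, j) \<in> I \<times> I. e i = e j}"
        have "S \<in> pats" using adm by (auto simp: S_def pats_def admissible_def)
        moreover have "T \<in> Pow (I \<times> I)" "Q \<in> eqs S" "diagram E I e T Q"
          by (auto simp: S_def T_def Q_def eqs_def diagram_def)
        moreover have "new V E e S" using a False unfolding new_def S_def by blast
        ultimately show ?thesis by blast
      qed
    qed
  qed
qed

text \<open>A universal quantifier is the negation of an existential one, applied to the
  quantifier-free equivalent of the body given by induction. Taking \<open>fv \<phi>\<close> as
  index set bounds the free variables as quantifier elimination requires.\<close>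

lemma qf_definable_sat:
  "wf_fm (ind_lang g) \<phi> \<Longrightarrow> qf_definable g (fv \<phi>) (\<lambda>V E e. sat (G_ind M V E) e \<phi>)"
proof (induction \<phi>)
  case (Imp \<phi> \<psi>)
  have mono: "qf_definable g (fv \<phi> \<union> fv \<psi>) P" if "qf_definable g J P" "J \<subseteq> fv \<phi> \<union> fv \<psi>" for J P
    using that unfolding qf_definable_def by (meson image_mono order_trans)
  show ?case using qf_definable_imp[OF mono mono] Imp by simp
next
  case (Forall x \<phi>)
  then obtain \<psi> where \<psi>: "wf_fm (ind_lang g) \<psi>" "quantifier_free \<psi>" "fv \<psi> \<subseteq> fv \<phi>"
    "\<And>V E e. \<lbrakk>admissible g V E; e ` fv \<phi> \<subseteq> V\<rbrakk> \<Longrightarrow>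
       sat (G_ind M V E) e \<psi> \<longleftrightarrow> sat (G_ind M V E) e \<phi>"
    unfolding qf_definable_def by auto
  have "qf_definable g (fv \<phi> - {x}) (\<lambda>V E e. \<exists>a\<in>V. sat (G_ind M V E) (e(x := a)) (Neg \<psi>))"
    by (rule qf_definable_ex) (use \<psi> finite_fv in auto)
  from qf_definable_not[OF this] show ?case
    unfolding fv.simps
  proof (rule qf_definable_cong)
    fix V E and e :: "nat \<Rightarrow> 'm list"
    assume "admissible g V E" and e: "e ` (fv \<phi> - {x}) \<subseteq> V"
    then have "sat (G_ind M V E) (e(x := a)) \<psi> \<longleftrightarrow> sat (G_ind M V E) (e(x := a)) \<phi>" if "a \<in> V" for a
      by (intro \<psi>(4)) (use that in auto)
    then show "(\<not> (\<exists>a\<in>V. sat (G_ind M V E) (e(x := a)) (Neg \<psi>))) \<longleftrightarrow>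
        sat (G_ind M V E) e (Forall x \<phi>)" by auto
  qed
next
  case Falsum
  then show ?case by (intro qf_definableI[of g Falsum]) auto
next
  case (Eq s t)
  then show ?case by (intro qf_definableI[of g "Eq s t"]) auto
next
  case (Rel r ts)
  then show ?case by (intro qf_definableI[of g "Rel r ts"]) auto
qed

section \<open>Quantifier elimination and elementary equivalence\<close>

lemma quantifier_elimination:
  assumes "admissible g V E"
  shows "has_quantifier_elimination (ind_lang g) (G_ind M V E)"
  unfolding has_quantifier_elimination_def theory_has_qe_def
proof (intro allI impI)
  fix \<phi> assume \<phi>: "wf_fm (ind_lang g) \<phi>"
  then obtain \<psi> where \<psi>: "wf_fm (ind_lang g) \<psi>" "quantifier_free \<psi>" "fv \<psi> \<subseteq> fv \<phi>"
    "\<And>e. e ` fv \<phi> \<subseteq> V \<Longrightarrow> sat (G_ind M V E) e \<psi> \<longleftrightarrow> sat (G_ind M V E) e \<phi>"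
    using qf_definable_sat[OF \<phi>] assms unfolding qf_definable_def by metis
  have "models (G_ind M V E) (univ_closure (Iff \<phi> \<psi>))"
    unfolding models_univ_closure using \<psi>(4) by auto
  moreover have "sentence (ind_lang g) (univ_closure (Iff \<phi> \<psi>))"
    by (rule sentence_univ_closure) (use \<phi> \<psi> in simp)
  ultimately show "\<exists>\<psi>. wf_fm (ind_lang g) \<psi> \<and> quantifier_free \<psi> \<and> fv \<psi> \<subseteq> fv \<phi> \<and>
      univ_closure (Iff \<phi> \<psi>) \<in> complete_theory (ind_lang g) (G_ind M V E)"
    using \<psi> unfolding complete_theory_def by blast
qed

text \<open>Every term is a variable, so a quantifier-free sentence contains neither equations nor
  edges. Its atoms are \<open>Falsum\<close> and symbols \<open>R \<phi> 0\<close> applied to the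
  empty tuple, whose truth is decided in \<open>M\<close> alone.\<close>

lemma sat_quantifier_free_sentence:
  "\<lbrakk>wf_fm (ind_lang g) \<psi>; quantifier_free \<psi>; fv \<psi> = {}\<rbrakk> \<Longrightarrow>
     sat (G_ind M V E) e \<psi> \<longleftrightarrow> sat (G_ind M V' E') e' \<psi>"
proof (induction \<psi>)
  case (Eq s t)
  then obtain j where "s = Var j" using wf_tm_ind_lang by (metis wf_fm.simps(2))
  then show ?case using Eq by simp
next
  case (Rel r ts)
  from Rel(1) show ?case
    by (cases rule: wf_fm_ind_lang_cases) (use Rel in \<open>auto simp: tuples_def\<close>)
qed auto

lemma models_sentence_iff:
  assumes "admissible g V E" "admissible g V' E'" "sentence (ind_lang g) \<sigma>"
  shows "models (G_ind M V E) \<sigma> \<longleftrightarrow> models (G_ind M V' E') \<sigma>"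
proof -
  have \<sigma>: "wf_fm (ind_lang g) \<sigma>" "fv \<sigma> = {}" using assms(3) by (auto simp: sentence_def)
  obtain \<psi> where \<psi>: "wf_fm (ind_lang g) \<psi>" "quantifier_free \<psi>" "fv \<psi> = {}"
    "\<And>V E e. admissible g V E \<Longrightarrow> sat (G_ind M V E) e \<psi> \<longleftrightarrow> sat (G_ind M V E) e \<sigma>"
    using qf_definable_sat[OF \<sigma>(1)] unfolding qf_definable_def \<sigma>(2) by auto
  show ?thesis
    using \<psi>(4) assms(1,2) sat_quantifier_free_sentence[OF \<psi>(1-3)] unfolding models_def by metis
qed

end

section \<open>Reducts and conclusion\<close>

lemma wf_tm_mono:
  assumes "fun_syms L \<subseteq> fun_syms L'" "fun_arity L = fun_arity L'" "wf_tm L t"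
  shows "wf_tm L' t"
  using assms(3) by (induction t) (use assms(1,2) in auto)

lemma sentence_mono:
  assumes "fun_syms L \<subseteq> fun_syms L'" "fun_arity L = fun_arity L'"
    "rel_syms L \<subseteq> rel_syms L'" "rel_arity L = rel_arity L'" "sentence L \<sigma>"
  shows "sentence L' \<sigma>"
proof -
  have "wf_fm L \<phi> \<Longrightarrow> wf_fm L' \<phi>" for \<phi>
    by (induction \<phi>) (use assms(3,4) wf_tm_mono[OF assms(1,2)] in auto)
  then show ?thesis using assms(5) by (simp add: sentence_def)
qed

lemma elementarily_equivalent_reduct:
  assumes "\<And>\<sigma>. sentence L' \<sigma> \<Longrightarrow> models M \<sigma> \<longleftrightarrow> models N \<sigma>"
    and "\<And>\<sigma>. sentence L \<sigma> \<Longrightarrow> sentence L' \<sigma>"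
  shows "elementarily_equivalent L M N"
  using assms by (auto simp: elementarily_equivalent_def complete_theory_def)

theorem theorem3p3:
  fixes L :: "('f, 'r) language"
    and M :: "('f, 'r, 'm) struct"
    and n :: nat
    and X V1 V2 :: "'m list set"
    and d :: "'m list \<Rightarrow> 'm list \<Rightarrow> real"
    and E1 E2 :: "('m list \<times> 'm list) set"
  assumes "Metric_space X d"
    and "separable_space (Metric_space.mtopology X d)"
    and "without_isolated_points X d"
    and "defining_structure L M n X d"
    and "independent_set L M n X d V1" and "dense_subset X d V1"
    and "independent_set L M n X d V2" and "dense_subset X d V2"
    and "thickness_definable L M n X d"
    and "gec_graph X d V1 E1"
    and "gec_graph X d V2 E2"
  shows "elementarily_equivalent (L_ind_E L n) (G_ind M V1 E1) (G_ind M V2 E2)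
    \<and> elementarily_equivalent L_graph (G_ind M V1 E1) (G_ind M V2 E2)
    \<and> elementarily_equivalent (L_ind L n) (G_ind M V1 E1) (G_ind M V2 E2)
    \<and> has_quantifier_elimination (L_ind L n) (V_ind M V1)
    \<and> has_quantifier_elimination (L_ind_E L n) (G_ind M V1 E1)"
proof -
  interpret Metric_space X d by fact
  interpret thickness_definable_space X d L M n
    by unfold_locales (use assms in auto)
  have lang: "ind_lang True = L_ind_E L n" "ind_lang False = L_ind L n"
    by (simp_all add: ind_lang_def)
  \<comment> \<open>\<open>V_ind M V1\<close> is \<open>G_ind M V1 {}\<close>, so the third fact
    covers the bare vertex set.\<close>
  have adm: "admissible True V1 E1" "admissible True V2 E2" "admissible False V1 {}"
    using assms by (simp_all add: admissible_def)
  note equiv = elementarily_equivalent_reduct[OF models_sentence_iff[OF adm(1,2), unfolded lang]]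
  have "sentence (L_ind_E L n) \<sigma>" if "sentence L_graph \<sigma> \<or> sentence (L_ind L n) \<sigma>" for \<sigma>
    using that
    by (auto elim!: sentence_mono[rotated 4]
        simp: L_graph_def L_ind_def L_ind_E_def relational_lang_def)
  then show ?thesis
    using equiv quantifier_elimination[OF adm(3)] quantifier_elimination[OF adm(1)]
    unfolding lang V_ind_def by blast
qed

end
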